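(* There exists a bounded sequence $(\lambda_n)_{n\ge1}$ of positive real numbers such that $\lim_{n\to\infty}F_n^{n_1}(0)=\infty$ for every integer $n_1\ge 0$, but $J(\lambda_n)\neq\mathbb{C}$.
   Context: For a bounded sequence $(\lambda_n)_{n\ge1}$ of positive real numbers put $f_{\lambda_n}(z)=\lambda_n e^z$ for $z\in\mathbb{C}$, and $F_n=f_{\lambda_n}\circ f_{\lambda_{n-1}}\circ\dots\circ f_{\lambda_1}$. For $n_1\ge0$ and $n\ge1$ write $F_n^{n_1}=f_{\lambda_{n_1+n}}\circ\dots\circ f_{\lambda_{n_1+1}}$ (the composition of $n$ functions starting after index $n_1$). The Fatou set $F(\lambda_n)$ is the set of all $z\in\mathbb{C}$ having an open neighbourhood on which the family $(F_n)_{n\ge 1}$ is normal, i.e. every sequence of members of the family has a subsequence converging almost uniformly (locally uniformly; as usual for normal families, convergence to $\infty$ is allowed). The Julia set is $J(\lambda_n)=\mathbb{C}\setminus F(\lambda_n)$. *)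

theory Defs
  imports "HOL-Complex_Analysis.Complex_Analysis"
begin

text \<open>A sequence \<open>(\<lambda>\<^sub>n)\<^sub>n\<^sub>\<ge>\<^sub>1\<close> is a function on \<^typ>\<open>nat\<close> whose value at \<open>0\<close> is never used.\<close>

definition exp_map :: "real \<Rightarrow> complex \<Rightarrow> complex" where
  "exp_map c z = of_real c * exp z"

text \<open>\<open>comp_from lam m n\<close> is \<open>F\<^sub>n\<^sup>m\<close>: the composition of the \<open>n\<close> maps with indices
  \<open>m + 1, \<dots>, m + n\<close>, the map with index \<open>m + 1\<close> being applied first.\<close>

primrec comp_from :: "(nat \<Rightarrow> real) \<Rightarrow> nat \<Rightarrow> nat \<Rightarrow> complex \<Rightarrow> complex" where
  "comp_from lam m 0 = id"
| "comp_from lam m (Suc n) = exp_map (lam (m + Suc n)) \<circ> comp_from lam m n"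

definition comp_seq :: "(nat \<Rightarrow> real) \<Rightarrow> nat \<Rightarrow> complex \<Rightarrow> complex" where
  "comp_seq lam n = comp_from lam 0 n"

text \<open>Almost uniform convergence is uniform convergence on compact subsets.\<close>

definition converges_locally_uniformly ::
  "complex set \<Rightarrow> (nat \<Rightarrow> complex \<Rightarrow> complex) \<Rightarrow> (complex \<Rightarrow> complex) \<Rightarrow> bool" where
  "converges_locally_uniformly U h g \<longleftrightarrow>
     (\<forall>K. compact K \<and> K \<subseteq> U \<longrightarrow> uniform_limit K h g sequentially)"

definition converges_locally_uniformly_to_infinity ::
  "complex set \<Rightarrow> (nat \<Rightarrow> complex \<Rightarrow> complex) \<Rightarrow> bool" where
  "converges_locally_uniformly_to_infinity U h \<longleftrightarrow>
     (\<forall>K. compact K \<and> K \<subseteq> U \<longrightarrow> (\<forall>B::real. \<forall>\<^sub>F n in sequentially. \<forall>z\<in>K. B < norm (h n z)))"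

text \<open>The limit is finite on all of \<open>U\<close> or infinite on all of \<open>U\<close>. For holomorphic functions on a
  connected \<open>U\<close> these are the only possible limits in the spherical metric; as the Fatou set only
  asks for some neighbourhood of each point, disconnected \<open>U\<close> make no difference there.\<close>

definition normal_family :: "complex set \<Rightarrow> (complex \<Rightarrow> complex) set \<Rightarrow> bool" where
  "normal_family U \<F> \<longleftrightarrow>
     (\<forall>h :: nat \<Rightarrow> complex \<Rightarrow> complex. range h \<subseteq> \<F> \<longrightarrow>
        (\<exists>r :: nat \<Rightarrow> nat. strict_mono r \<and>
           ((\<exists>g. converges_locally_uniformly U (h \<circ> r) g) \<or>
            converges_locally_uniformly_to_infinity U (h \<circ> r))))"

definition fatou_set :: "(nat \<Rightarrow> real) \<Rightarrow> complex set" where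
  "fatou_set lam = {z. \<exists>U. open U \<and> z \<in> U \<and> normal_family U (comp_seq lam ` {1..})}"

definition julia_set :: "(nat \<Rightarrow> real) \<Rightarrow> complex set" where
  "julia_set lam = UNIV - fatou_set lam"

end

theory Submission
  imports Defs
begin

text \<open>The parameters \<open>\<lambda>\<^sub>n\<close> are chosen so that one orbit \<open>z\<^sub>n\<close> has prescribed arguments
  \<open>\<theta>\<^sub>n\<close> tending to \<open>0\<close>. Since \<open>Im z\<^sub>n = \<theta>\<^sub>n\<^sub>+\<^sub>1\<close>, this gives
  \<open>z\<^sub>n = \<theta>\<^sub>n\<^sub>+\<^sub>1 (cot \<theta>\<^sub>n + \<i>)\<close>, and \<open>\<lambda>\<^sub>n\<close> tends to \<open>1/e\<close>.
  The map with index \<open>n + 1\<close> expands the hyperbolic metric of the upper half-plane at \<open>z\<^sub>n\<close> by a factor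
  \<open>1 + O(\<theta>\<^sub>n\<^sub>+\<^sub>1\<^sup>2)\<close>, so \<open>\<Sum>\<theta>\<^sub>n\<^sup>2 < \<infinity>\<close> keeps a disc around \<open>z\<^sub>0\<close> close to the bounded orbit
  \<open>z\<^sub>n\<close>, and Montel's theorem puts \<open>z\<^sub>0\<close> in the Fatou set. For a real orbit \<open>x\<^sub>n\<close> the slope
  \<open>(x\<^sub>n - Re z\<^sub>n) / Im z\<^sub>n\<close> grows by at least \<open>\<theta>\<^sub>n\<^sub>+\<^sub>1 / 4\<close> in each step, so \<open>\<Sum>\<theta>\<^sub>n = \<infinity>\<close> makes
  it large; then the quadratic term of \<open>exp\<close> takes over and \<open>x\<^sub>n\<close> tends to infinity.\<close>

section \<open>Elementary estimates for sin, cos and sinh\<close>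

lemma abs_sin_minus_self_le: "\<bar>sin x - x\<bar> \<le> \<bar>x\<bar> ^ 3 / 6" for x :: real
  using Maclaurin_sin_bound[of x 3]
  by (simp add: numeral_3_eq_3 sin_coeff_def lessThan_Suc fact_numeral)

lemma sin_bounds:
  fixes y :: real
  assumes "0 < y" "y \<le> 1"
  shows "0 < sin y" "sin y \<le> y" "y - y ^ 3 / 6 \<le> sin y" "y / 2 \<le> sin y"
    "cos y \<le> 1 - 5 / 12 * y\<^sup>2"
proof -
  show "0 < sin y"
    using assms pi_gt3 by (intro sin_gt_zero) auto
  show "sin y \<le> y"
    using assms by (intro sin_x_le_x) auto
  show *: "y - y ^ 3 / 6 \<le> sin y"
    using abs_sin_minus_self_le[of y] assms unfolding abs_of_pos[OF assms(1)] by linarith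
  have "y ^ 3 \<le> y"
    using assms power_decreasing[of 1 3 y] by simp
  with * assms show "y / 2 \<le> sin y" by linarith
  \<comment> \<open>The cosine bound follows from the cubic sine bound at the half angle. Its
    constant 5/12 = 1/6 + 1/4 is exactly what \<open>slope_step\<close> spends.\<close>
  define t where "t = y / 2"
  have t: "0 < t" "t \<le> 1/2" using assms by (auto simp: t_def)
  have "t - t ^ 3 / 6 \<le> sin t"
    using abs_sin_minus_self_le[of t] t unfolding abs_of_pos[OF t(1)] by linarith
  moreover have "t ^ 3 \<le> t * (1/4)"
  proof -
    have "t\<^sup>2 \<le> (1/2)\<^sup>2" using t by (intro power_mono) auto
    thus ?thesis using t by (simp add: power3_eq_cube power2_eq_square)
  qed
  ultimately have "23 / 24 * t \<le> sin t" by linarith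
  hence "(23 / 24 * t)\<^sup>2 \<le> (sin t)\<^sup>2" using t by (intro power_mono) auto
  hence "5 / 6 * t\<^sup>2 \<le> (sin t)\<^sup>2"
    by (rule order.trans[rotated]) (simp add: power2_eq_square)
  moreover have "cos y = 1 - 2 * (sin t)\<^sup>2"
    using cos_double_sin[of t] by (simp add: t_def)
  ultimately show "cos y \<le> 1 - 5 / 12 * y\<^sup>2"
    by (simp add: t_def power2_eq_square)
qed

lemma norm_sinh_minus_self_le:
  fixes a :: complex
  assumes "norm a \<le> 1/2"
  shows "norm (sinh a - a) \<le> norm a ^ 3"
proof -
  have bound: "norm (exp b - (1 + b + b\<^sup>2 / 2)) \<le> norm a ^ 3" if "norm b = norm a" for b :: complex
  proof -
    have "exp \<bar>Re b\<bar> \<le> exp (1/2 :: real)"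
      using abs_Re_le_cmod[of b] that assms by simp
    also have "\<dots> \<le> 2"
      using exp_bound_half[of "1/2 :: real"] by simp
    finally have "exp \<bar>Re b\<bar> * norm b ^ 3 / 2 \<le> 2 * norm b ^ 3 / 2"
      by (intro divide_right_mono mult_right_mono) auto
    with Taylor_exp[of b 2] that show ?thesis
      by (simp add: numeral_2_eq_2 numeral_3_eq_3 atMost_Suc algebra_simps)
  qed
  \<comment> \<open>The quadratic terms at a and -a cancel, leaving only two cubic Taylor
    remainders.\<close>
  have "sinh a - a = ((exp a - (1 + a + a\<^sup>2 / 2)) - (exp (-a) - (1 + (-a) + (-a)\<^sup>2 / 2))) / 2"
    by (simp add: sinh_field_def field_simps)
  also have "norm \<dots> = norm ((exp a - (1 + a + a\<^sup>2 / 2)) - (exp (-a) - (1 + (-a) + (-a)\<^sup>2 / 2))) / 2"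
    by (simp only: norm_divide) simp
  also have "\<dots> \<le> (norm a ^ 3 + norm a ^ 3) / 2"
    by (intro divide_right_mono order.trans[OF norm_triangle_ineq4] add_mono bound) auto
  finally show ?thesis by simp
qed

section \<open>Distortion of half-plane geometry by exp\<close>

lemma exp_diff_eq_sinh: "exp w - exp z = 2 * exp ((w + z) / 2) * sinh ((w - z) / 2)"
  for w z :: complex
  by (simp add: sinh_field_def algebra_simps flip: exp_add) (simp add: field_simps)

text \<open>Up to a factor \<open>1 + O(y\<^sup>2)\<close>, \<open>exp\<close> does not expand pseudo-hyperbolic balls of the upper
  half-plane centred at height \<open>y\<close>: the factor \<open>exp ((w + z) / 2)\<close> has the same modulus for
  \<open>z\<close> and \<open>cnj z\<close>, and \<open>sinh\<close> has no quadratic term.\<close>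

lemma pseudohyperbolic_exp_le:
  fixes w z :: complex
  assumes y: "0 < Im z" "Im z \<le> 1/8" and q: "0 \<le> q" "q \<le> 1/2"
    and le: "norm (w - z) \<le> q * norm (w - cnj z)"
  shows "norm (exp w - exp z) \<le> q * (1 + 6 * (Im z)\<^sup>2) * norm (exp w - exp (cnj z))"
proof -
  define y where "y = Im z"
  define a where "a = (w - z) / 2"
  define b where "b = (w - cnj z) / 2"
  have ba: "b = a + \<i> * of_real y"
    by (simp add: a_def b_def y_def complex_eq_iff field_simps)
  have le': "norm a \<le> q * norm b"
    using le by (simp add: a_def b_def norm_divide)
  \<comment> \<open>As q \<le> 1/2, this gives |b| \<le> |b|/2 + y. Both arguments of sinh are thus
    O(y), and their cubic errors are relative errors O(y^2).\<close>
  have "norm b \<le> norm a + y"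
    using norm_triangle_ineq[of a "\<i> * of_real y"] y by (simp add: ba norm_mult y_def)
  moreover have "q * norm b \<le> 1/2 * norm b"
    using q by (intro mult_right_mono) auto
  ultimately have nb: "norm a \<le> y" "norm b \<le> 2 * y"
    using le' by linarith+
  have small: "norm a \<le> 1/2" "norm b \<le> 1/2"
    using nb y by (auto simp: y_def)
  have y2: "y * y \<le> 1 / 64"
    using mult_mono[of y "1/8" y "1/8"] y by (simp add: y_def)
  have "norm (sinh a) \<le> norm a + norm a ^ 3"
    using norm_sinh_minus_self_le[OF small(1)] norm_triangle_sub[of "sinh a" a] by linarith
  also have "norm a ^ 3 \<le> y\<^sup>2 * norm a"
    using mult_right_mono[OF power_mono[OF nb(1), of 2], of "norm a"]
    by (simp add: power3_eq_cube power2_eq_square)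
  finally have 1: "norm (sinh a) \<le> (1 + y\<^sup>2) * norm a"
    by (simp add: algebra_simps)
  have "norm b - norm b ^ 3 \<le> norm (sinh b)"
    using norm_sinh_minus_self_le[OF small(2)] norm_triangle_sub[of b "sinh b"]
    by (simp add: norm_minus_commute)
  moreover have "norm b ^ 3 \<le> 4 * y\<^sup>2 * norm b"
    using mult_right_mono[OF power_mono[OF nb(2), of 2], of "norm b"]
    by (simp add: power3_eq_cube power2_eq_square)
  ultimately have 2: "(1 - 4 * y\<^sup>2) * norm b \<le> norm (sinh b)"
    by (simp add: algebra_simps)
  \<comment> \<open>With s = y^2 the right side exceeds the left by s (1 - 24 s), and s \<le>
    1/64.\<close>
  have coeff: "1 + y\<^sup>2 \<le> (1 + 6 * y\<^sup>2) * (1 - 4 * y\<^sup>2)"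
    using mult_right_mono[OF y2, of "y * y"] mult_nonneg_nonneg[of y y] y
    by (simp add: power2_eq_square algebra_simps y_def)
  have "norm (sinh a) \<le> (1 + y\<^sup>2) * (q * norm b)"
    by (rule order.trans[OF 1 mult_left_mono[OF le']]) simp
  also have "\<dots> \<le> ((1 + 6 * y\<^sup>2) * (1 - 4 * y\<^sup>2)) * (q * norm b)"
    using q by (intro mult_right_mono[OF coeff]) auto
  also have "\<dots> = q * (1 + 6 * y\<^sup>2) * ((1 - 4 * y\<^sup>2) * norm b)"
    by (simp add: algebra_simps)
  also have "\<dots> \<le> q * (1 + 6 * y\<^sup>2) * norm (sinh b)"
    using q by (intro mult_left_mono[OF 2]) auto
  finally have main: "norm (sinh a) \<le> q * (1 + 6 * y\<^sup>2) * norm (sinh b)" .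
  have "norm (exp w - exp z) = 2 * exp ((Re w + Re z) / 2) * norm (sinh a)"
    unfolding exp_diff_eq_sinh a_def by (simp add: norm_mult)
  also have "\<dots> \<le> 2 * exp ((Re w + Re z) / 2) * (q * (1 + 6 * y\<^sup>2) * norm (sinh b))"
    by (intro mult_left_mono[OF main]) auto
  also have "\<dots> = q * (1 + 6 * y\<^sup>2) * norm (exp w - exp (cnj z))"
    unfolding exp_diff_eq_sinh[of w "cnj z"] b_def by (simp add: norm_mult)
  finally show ?thesis by (simp add: y_def)
qed

section \<open>The base orbit and its parameters\<close>

text \<open>The constant 4 makes \<open>6 \<theta>\<^sub>n\<^sup>2 \<le> 1 / (n + 2)\<^sup>2\<close>, so that the hyperbolic expansion factors
  are absorbed by the telescoping factors in \<open>angle_expansion_le\<close>.\<close>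

definition angle :: "nat \<Rightarrow> real" where
  "angle n = 1 / (4 * (real n + 2))"

definition base_orbit :: "nat \<Rightarrow> complex" where
  "base_orbit n = Complex (angle (n + 1) * cot (angle n)) (angle (n + 1))"

text \<open>For n \<ge> 1 the exponential cancels the factor e^(Re z) of the preceding orbit point
  z, and the quotient is the modulus of \<open>base_orbit n\<close>. Maps have indices from 1 on, so
  the truncated n - 1 is harmless.\<close>

definition base_param :: "nat \<Rightarrow> real" where
  "base_param n = angle (n + 1) / sin (angle n) * exp (- (angle n * cot (angle (n - 1))))"

lemma angle_pos: "0 < angle n"
  and angle_le: "angle n \<le> 1/8"
  and angle_Suc_le: "angle (Suc n) \<le> angle n"
  by (simp_all add: angle_def field_simps)

lemma angle_bounds: "0 < angle n" "angle n \<le> 1"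
  using angle_pos[of n] angle_le[of n] by auto

lemmas sin_angle = sin_bounds[OF angle_bounds]

lemma Im_base_orbit [simp]: "Im (base_orbit n) = angle (Suc n)"
  by (simp add: base_orbit_def)

text \<open>The upper bound, an instance of t cos t \<le> sin t, makes the initial gap of the orbit
  of 0 at least -1. The lower bound keeps the parameters bounded and makes the orbit of 0 dominate
  its gap.\<close>

lemma Re_base_orbit_bounds: "0 \<le> Re (base_orbit n)" "Re (base_orbit n) \<le> 1"
proof -
  have c: "0 \<le> cos (angle n)"
    using angle_bounds[of n] pi_gt3 by (intro cos_ge_zero) auto
  show "0 \<le> Re (base_orbit n)"
    using c sin_angle(1)[of n] angle_pos[of "Suc n"] by (simp add: base_orbit_def cot_def)
  have "angle (Suc n) * cos (angle n) \<le> sin (angle n)"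
  proof -
    have t: "angle n \<le> 1/8" "0 < angle n" using angle_le[of n] angle_pos[of n] by auto
    have "angle (Suc n) * cos (angle n) \<le> angle n * (1 - 5 / 12 * (angle n)\<^sup>2)"
      using c sin_angle(5)[of n] angle_Suc_le[of n] t by (intro mult_mono) auto
    also have "\<dots> = angle n - 5 / 12 * angle n ^ 3"
      by (simp add: algebra_simps power2_eq_square power3_eq_cube)
    also have "\<dots> \<le> angle n - angle n ^ 3 / 6"
      using t by simp
    also have "\<dots> \<le> sin (angle n)" by (rule sin_angle)
    finally show ?thesis .
  qed
  thus "Re (base_orbit n) \<le> 1"
    using sin_angle(1)[of n] by (simp add: base_orbit_def cot_def field_simps)
qed

lemma norm_base_orbit_le: "norm (base_orbit n) \<le> 2"
  using Re_base_orbit_bounds[of n] cmod_le[of "base_orbit n"] angle_bounds[of "Suc n"] by simp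

lemma base_param_Suc:
  "base_param (Suc n) = angle (Suc (Suc n)) / sin (angle (Suc n)) * exp (- Re (base_orbit n))"
  by (simp add: base_param_def base_orbit_def)

lemma base_param_pos: "0 < base_param n"
  using sin_angle(1)[of n] angle_pos[of "n + 1"] by (simp add: base_param_def)

lemma base_param_le: "base_param (Suc n) \<le> 2"
proof -
  have "angle (Suc (Suc n)) / sin (angle (Suc n)) \<le> 2"
    using sin_angle(1,4)[of "Suc n"] angle_Suc_le[of "Suc n"] by (simp add: field_simps)
  hence "base_param (Suc n) \<le> 2 * 1"
    unfolding base_param_Suc using Re_base_orbit_bounds(1)[of n] by (intro mult_mono) auto
  thus ?thesis by simp
qed

lemma exp_map_base_orbit: "exp_map (base_param (Suc n)) (base_orbit n) = base_orbit (Suc n)"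
proof -
  define x where "x = Re (base_orbit n)"
  define t where "t = angle (Suc n)"
  define k where "k = angle (Suc (Suc n)) / sin t"
  have cancel: "k * exp (- x) * (exp x * v) = k * v" for v
    using exp_minus_inverse[of x] by (simp add: exp_minus)
  have "exp_map (base_param (Suc n)) (base_orbit n) = Complex (k * cos t) (k * sin t)"
    unfolding exp_map_def base_param_Suc x_def[symmetric] t_def[symmetric] k_def[symmetric]
    by (simp add: complex_eq_iff Re_exp Im_exp cancel flip: x_def t_def)
  also have "\<dots> = base_orbit (Suc n)"
    using sin_angle(1)[of "Suc n"] by (simp add: base_orbit_def cot_def k_def t_def)
  finally show ?thesis .
qed

section \<open>Boundedness near the base orbit and normality\<close>

lemma exp_map_cnj: "exp_map c (cnj z) = cnj (exp_map c z)"
  by (simp add: exp_map_def exp_cnj)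

lemma comp_from_holomorphic: "comp_from lam m n holomorphic_on S"
proof (induction n)
  case (Suc n)
  have "(\<lambda>z. of_real (lam (m + Suc n)) * exp (comp_from lam m n z)) holomorphic_on S"
    by (intro holomorphic_intros Suc)
  thus ?case by (simp add: exp_map_def o_def)
qed (simp add: holomorphic_on_id)

text \<open>With t = n + 3 this rests on (1 - 1/t)(1 + 1/t^2) \<le> 1 - 1/(t + 1), where the
  difference is 1/(t^3 (t + 1)).\<close>

lemma angle_expansion_le:
  "(1 - 1 / (real n + 3)) * (1 + 6 * (angle (Suc n))\<^sup>2) \<le> 1 - 1 / (real n + 4)"
proof -
  define t where "t = real n + 3"
  have t: "t \<ge> 3" by (simp add: t_def)
  have "6 * (angle (Suc n))\<^sup>2 \<le> 1 / (t * t)"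
  proof -
    have "angle (Suc n) = 1 / (4 * t)" by (simp add: angle_def t_def algebra_simps)
    hence "6 * (angle (Suc n))\<^sup>2 = 3 / 8 * (1 / (t * t))" by (simp add: power2_eq_square)
    also have "\<dots> \<le> 1 / (t * t)" using t by (intro mult_left_le_one_le) auto
    finally show ?thesis .
  qed
  hence "(1 - 1 / t) * (1 + 6 * (angle (Suc n))\<^sup>2) \<le> (1 - 1 / t) * (1 + 1 / (t * t))"
    using t by (intro mult_left_mono) auto
  also have "\<dots> \<le> 1 - 1 / (t + 1)"
  proof -
    have "1 - 1 / (t + 1) - (1 - 1 / t) * (1 + 1 / (t * t)) = 1 / (t ^ 3 * (t + 1))"
      using t by (simp add: divide_simps) (simp add: algebra_simps power3_eq_cube)
    also have "\<dots> \<ge> 0" using t by simp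
    finally show ?thesis by simp
  qed
  finally show ?thesis by (simp add: t_def algebra_simps)
qed

text \<open>The pseudo-hyperbolic radius starts at 1/3 and increases towards 1/2 without reaching
  it, so \<open>pseudohyperbolic_exp_le\<close> applies at every step. Scaling by a positive
  parameter preserves the ratio, and conjugation commutes with the maps.\<close>

lemma comp_from_pseudohyperbolic_le:
  assumes "norm (w - base_orbit 0) \<le> 1 / 3 * norm (w - cnj (base_orbit 0))"
  shows "norm (comp_from base_param 0 n w - base_orbit n)
    \<le> 1 / 2 * (1 - 1 / (real n + 3)) * norm (comp_from base_param 0 n w - cnj (base_orbit n))"
proof (induction n)
  case 0
  then show ?case using assms by simp
next
  case (Suc n)
  define u where "u = comp_from base_param 0 n w"
  define z where "z = base_orbit n"
  define c where "c = base_param (Suc n)"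
  define q where "q = 1 / 2 * (1 - 1 / (real n + 3))"
  have c: "c > 0" by (simp add: c_def base_param_pos)
  have q: "0 \<le> q" "q \<le> 1/2" by (auto simp: q_def field_simps)
  have "norm (exp u - exp z) \<le> q * (1 + 6 * (Im z)\<^sup>2) * norm (exp u - exp (cnj z))"
    using Suc q angle_pos angle_le by (intro pseudohyperbolic_exp_le) (auto simp: z_def u_def q_def)
  also have "\<dots> \<le> 1 / 2 * (1 - 1 / (real n + 4)) * norm (exp u - exp (cnj z))"
    using angle_expansion_le[of n] by (intro mult_right_mono) (auto simp: z_def q_def)
  finally have "c * norm (exp u - exp z)
      \<le> c * (1 / 2 * (1 - 1 / (real n + 4)) * norm (exp u - exp (cnj z)))"
    using c by (intro mult_left_mono) auto
  moreover have "c * norm (exp u - exp v) = norm (exp_map c u - exp_map c v)" for v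
    using c by (simp add: exp_map_def norm_mult flip: right_diff_distrib)
  ultimately have "norm (exp_map c u - exp_map c z)
      \<le> 1 / 2 * (1 - 1 / (real n + 4)) * norm (exp_map c u - exp_map c (cnj z))"
    by (metis mult.left_commute)
  thus ?case
    unfolding exp_map_cnj by (simp add: u_def z_def c_def exp_map_base_orbit algebra_simps)
qed

lemma comp_from_bounded_near_base_orbit:
  assumes "w \<in> ball (base_orbit 0) (angle 1 / 2)"
  shows "norm (comp_from base_param 0 n w) \<le> 3"
proof -
  define z where "z = base_orbit 0"
  have two_height: "norm (v - cnj v) = 2 * \<bar>Im v\<bar>" for v
    by (simp add: complex_diff_cnj norm_mult)
  have "norm (w - z) < angle 1 / 2"
    using assms by (simp add: z_def dist_norm norm_minus_commute)
  moreover have "2 * angle 1 \<le> norm (w - z) + norm (w - cnj z)"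
    using norm_triangle_ineq4[of "w - cnj z" "w - z"] two_height[of z] angle_pos[of 1]
    by (simp add: z_def)
  \<comment> \<open>The radius is half the height h of z, so |w - cnj z| \<ge> 2h - h/2, which is at
    least 3 |w - z|.\<close>
  ultimately have "norm (w - z) \<le> 1 / 3 * norm (w - cnj z)" by linarith
  hence *: "norm (comp_from base_param 0 n w - base_orbit n)
    \<le> 1 / 2 * (1 - 1 / (real n + 3)) * norm (comp_from base_param 0 n w - cnj (base_orbit n))"
    unfolding z_def by (rule comp_from_pseudohyperbolic_le)
  define u where "u = comp_from base_param 0 n w"
  have "1 / 2 * (1 - 1 / (real n + 3)) * norm (u - cnj (base_orbit n))
      \<le> 1 / 2 * norm (u - cnj (base_orbit n))"
    by (intro mult_right_mono) (auto simp: field_simps)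
  moreover have "norm (u - cnj (base_orbit n)) \<le> norm (u - base_orbit n) + 2 * angle (Suc n)"
    using norm_triangle_ineq[of "u - base_orbit n" "base_orbit n - cnj (base_orbit n)"]
      two_height[of "base_orbit n"] angle_pos[of "Suc n"] by simp
  ultimately have "norm (u - base_orbit n) \<le> 2 * angle (Suc n)"
    using * unfolding u_def by linarith
  moreover have "norm u \<le> norm (base_orbit n) + norm (u - base_orbit n)"
    by (rule norm_triangle_sub)
  ultimately show ?thesis
    using norm_base_orbit_le[of n] angle_le[of "Suc n"] unfolding u_def by linarith
qed

lemma base_orbit_in_fatou_set: "base_orbit 0 \<in> fatou_set base_param"
proof -
  define U where "U = ball (base_orbit 0) (angle 1 / 2)"
  have "normal_family U (comp_seq base_param ` {1..})"
    unfolding normal_family_def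
  proof (intro allI impI)
    fix h :: "nat \<Rightarrow> complex \<Rightarrow> complex"
    assume h: "range h \<subseteq> comp_seq base_param ` {1..}"
    have "open U" by (simp add: U_def)
    then obtain g r where "strict_mono (r :: nat \<Rightarrow> nat)"
      "\<And>K. \<lbrakk>compact K; K \<subseteq> U\<rbrakk> \<Longrightarrow> uniform_limit K (h \<circ> r) g sequentially"
    proof (rule Montel)
      show "f holomorphic_on U" if "f \<in> comp_seq base_param ` {1..}" for f
        using that comp_from_holomorphic by (auto simp: comp_seq_def)
      show "\<exists>B. \<forall>f\<in>comp_seq base_param ` {1..}. \<forall>z\<in>K. norm (f z) \<le> B" if "K \<subseteq> U" for K
        using that comp_from_bounded_near_base_orbit unfolding U_def comp_seq_def by blast
    qed (use h in auto)
    thus "\<exists>r. strict_mono r \<and> ((\<exists>g. converges_locally_uniformly U (h \<circ> r) g) \<or>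
        converges_locally_uniformly_to_infinity U (h \<circ> r))"
      unfolding converges_locally_uniformly_def by blast
  qed
  moreover have "open U" "base_orbit 0 \<in> U"
    using angle_pos[of 1] by (auto simp: U_def)
  ultimately show ?thesis unfolding fatou_set_def by blast
qed

section \<open>Escape of the real orbits\<close>

text \<open>Here 1 - cos y gains 5/12 y^2, while replacing sin y by y costs at most y^2/6, for
  negative d thanks to d \<ge> -1. The remaining y^2/4 pays for the increment.\<close>

lemma slope_step:
  fixes d y :: real
  assumes y: "0 < y" "y \<le> 1" and d: "-1 \<le> d"
  shows "d / y + y / 4 \<le> (exp d - cos y) / sin y"
proof -
  note s = sin_bounds[OF y]
  have "d / y * sin y \<le> d + y\<^sup>2 / 6"
  proof (cases "d \<ge> 0")
    case True
    hence "d / y * sin y \<le> d / y * y" using s y by (intro mult_left_mono) auto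
    also have "\<dots> = d" using y by simp
    also have "\<dots> \<le> d + y\<^sup>2 / 6" by simp
    finally show ?thesis .
  next
    case False
    hence "d / y * sin y \<le> d / y * (y - y ^ 3 / 6)"
      using s y by (intro mult_left_mono_neg) (auto simp: divide_le_0_iff)
    also have "\<dots> = d + (- d) * (y\<^sup>2 / 6)"
      using y by (simp add: field_simps power2_eq_square power3_eq_cube)
    also have "(- d) * (y\<^sup>2 / 6) \<le> 1 * (y\<^sup>2 / 6)"
      using d by (intro mult_right_mono) auto
    finally show ?thesis by simp
  qed
  moreover have "y / 4 * sin y \<le> y\<^sup>2 / 4"
    using s y by (simp add: power2_eq_square)
  moreover have "1 + d \<le> exp d" by (rule exp_ge_add_one_self)
  ultimately have "(d / y + y / 4) * sin y \<le> exp d - cos y"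
    using s(5) unfolding distrib_right by linarith
  thus ?thesis using s(1) by (simp add: pos_le_divide_eq)
qed

text \<open>The ratio of consecutive angles is t/(t + 1), a relative loss of about 1/t. The
  quadratic term of exp is a relative gain d/2, which wins once d \<ge> 8/t, that is, d \<ge> 32
  \<open>angle n\<close>.\<close>

lemma gap_step:
  assumes "32 * angle n \<le> d"
  shows "d + d\<^sup>2 / 8 \<le> angle (Suc n) / sin (angle n) * (exp d - cos (angle n))"
proof -
  define t where "t = real n + 2"
  have t: "t \<ge> 2" by (simp add: t_def)
  have d: "8 / t \<le> d" using assms by (simp add: angle_def t_def field_simps)
  have "0 < 8 / t" using t by simp
  hence d0: "0 < d" using d by linarith
  have r: "angle (Suc n) / angle n = t / (t + 1)"
    using t by (simp add: angle_def t_def field_simps)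
  have "1 + d / 8 \<le> t / (t + 1) * (1 + d / 2)"
  proof -
    have "8 \<le> d * t" using d t by (simp add: field_simps)
    moreover have "2 * d \<le> t * d" using t d0 by (intro mult_right_mono) auto
    moreover have "(1 + d / 8) * (t + 1) = t + d * t / 8 + 1 + d / 8"
        "t * (1 + d / 2) = t + d * t / 2"
      by (simp_all add: algebra_simps)
    ultimately have "(1 + d / 8) * (t + 1) \<le> t * (1 + d / 2)"
      by (simp only: mult.commute[of t d])
    thus ?thesis using t by (simp add: field_simps)
  qed
  hence "d * (1 + d / 8) \<le> d * (t / (t + 1) * (1 + d / 2))"
    using d0 by (intro mult_left_mono) auto
  also have "\<dots> = angle (Suc n) / angle n * (d + d\<^sup>2 / 2)"
    unfolding r by (simp add: algebra_simps power2_eq_square)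
  also have "\<dots> \<le> angle (Suc n) / sin (angle n) * (exp d - cos (angle n))"
  proof (intro mult_mono divide_left_mono)
    have "1 + d + d\<^sup>2 / 2 \<le> exp d" using exp_lower_Taylor_quadratic[of d] d0 by simp
    thus "d + d\<^sup>2 / 2 \<le> exp d - cos (angle n)" using cos_le_one[of "angle n"] by linarith
  qed (use sin_angle[of n] angle_pos[of n] angle_pos[of "Suc n"] d0 in auto)
  finally show ?thesis by (simp add: algebra_simps power2_eq_square)
qed

text \<open>The sequence never falls below d N after time N, so each increment is at least the fixed
  amount c (d N)^2 and growth is at least linear.\<close>

lemma filterlim_at_top_of_quadratic_growth:
  fixes d :: "nat \<Rightarrow> real"
  assumes pos: "0 < d N" and step: "\<And>n. n \<ge> N \<Longrightarrow> d n + c * (d n)\<^sup>2 \<le> d (Suc n)" and c: "c > 0"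
  shows "filterlim d at_top sequentially"
proof -
  have lower: "d N + real k * (c * (d N)\<^sup>2) \<le> d (N + k)" for k
  proof (induction k)
    case (Suc k)
    have "0 \<le> real k * (c * (d N)\<^sup>2)" using c by simp
    hence "d N \<le> d (N + k)" using Suc by linarith
    hence "c * (d N)\<^sup>2 \<le> c * (d (N + k))\<^sup>2"
      using pos c by (intro mult_left_mono power_mono) auto
    thus ?case using Suc step[of "N + k"] by (simp add: algebra_simps)
  qed simp
  have "filterlim (\<lambda>n. d N + (- real N + real n) * (c * (d N)\<^sup>2)) at_top sequentially"
    using pos c
    by (intro filterlim_tendsto_add_at_top[OF tendsto_const]
        filterlim_at_top_mult_tendsto_pos[OF tendsto_const] filterlim_real_sequentially) auto
  moreover have "\<forall>\<^sub>F n in sequentially. d N + (- real N + real n) * (c * (d N)\<^sup>2) \<le> d n"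
    using eventually_ge_at_top[of N]
  proof eventually_elim
    case (elim n)
    thus ?case using lower[of "n - N"] by (simp add: of_nat_diff)
  qed
  ultimately show ?thesis by (rule filterlim_at_top_mono)
qed

definition zero_orbit :: "nat \<Rightarrow> nat \<Rightarrow> real" where
  "zero_orbit m n = Re (comp_from base_param m n 0)"

lemma comp_from_zero_eq: "comp_from base_param m n 0 = of_real (zero_orbit m n)"
proof (induction n)
  case (Suc n)
  have "comp_from base_param m (Suc n) 0
      = of_real (base_param (m + Suc n) * exp (zero_orbit m n))"
    by (simp add: exp_map_def Suc exp_of_real)
  thus ?case unfolding zero_orbit_def by simp
qed (simp add: zero_orbit_def)

lemma zero_orbit_Suc:
  "zero_orbit m (Suc n) = base_param (Suc (m + n)) * exp (zero_orbit m n)"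
  using comp_from_zero_eq[of m n] unfolding zero_orbit_def[of m "Suc n"]
  by (simp add: exp_map_def exp_of_real)

text \<open>Both orbits are compared at the same absolute time m + n, so one argument covers every
  starting index.\<close>

definition gap :: "nat \<Rightarrow> nat \<Rightarrow> real" where
  "gap m n = zero_orbit m n - Re (base_orbit (m + n))"

lemma gap_Suc:
  "gap m (Suc n) = angle (Suc (Suc (m + n))) / sin (angle (Suc (m + n)))
     * (exp (gap m n) - cos (angle (Suc (m + n))))"
proof -
  have "zero_orbit m (Suc n)
      = angle (Suc (Suc (m + n))) / sin (angle (Suc (m + n))) * exp (gap m n)"
    by (simp add: gap_def zero_orbit_Suc base_param_Suc exp_diff exp_minus divide_inverse)
  moreover have "Re (base_orbit (m + Suc n))
      = angle (Suc (Suc (m + n))) / sin (angle (Suc (m + n))) * cos (angle (Suc (m + n)))"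
    by (simp add: base_orbit_def cot_def)
  ultimately show ?thesis
    by (simp add: gap_def[of m "Suc n"] right_diff_distrib)
qed

definition slope :: "nat \<Rightarrow> nat \<Rightarrow> real" where
  "slope m n = gap m n / angle (Suc (m + n))"

lemma slope_Suc:
  assumes "-1 \<le> gap m n"
  shows "slope m n + angle (Suc (m + n)) / 4 \<le> slope m (Suc n)"
  using slope_step[OF angle_bounds assms, of "Suc (m + n)"] angle_pos[of "Suc (Suc (m + n))"]
  by (simp add: slope_def gap_Suc)

text \<open>While the gap is at least -1 the slope increases. As the heights do not increase, a
  slope of at least -1/y keeps the next gap at least -1.\<close>

lemma gap_ge: "-1 \<le> gap m n"
proof (induction n)
  case 0
  then show ?case
    using Re_base_orbit_bounds(2)[of m] by (simp add: gap_def zero_orbit_def)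
next
  case (Suc n)
  define y where "y = angle (Suc (m + n))"
  define y' where "y' = angle (Suc (Suc (m + n)))"
  have y: "0 < y'" "y' \<le> y" "0 < y"
    by (auto simp: y_def y'_def angle_pos angle_Suc_le)
  have "- 1 / y' \<le> - 1 / y" using y by (simp add: frac_le)
  also have "\<dots> \<le> slope m n"
    unfolding slope_def y_def[symmetric] using Suc y by (intro divide_right_mono) auto
  also have "\<dots> \<le> slope m (Suc n)"
    using slope_Suc[OF Suc] angle_pos[of "Suc (m + n)"] by linarith
  finally have "- 1 / y' \<le> gap m (Suc n) / y'" by (simp add: slope_def y'_def)
  thus ?case using y(1) divide_le_cancel[of "-1" y' "gap m (Suc n)"] by linarith
qed

text \<open>Each slope increment is a sixteenth of the next harmonic term: 1/4 from
  \<open>slope_step\<close>, 1/4 from \<open>angle\<close>.\<close>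

lemma slope_ge_harm: "slope m 0 + (harm (m + n + 2) - harm (m + 2)) / 16 \<le> slope m n"
proof (induction n)
  case (Suc n)
  have "harm (m + Suc n + 2) = harm (m + n + 2) + 4 * angle (Suc (m + n))"
    by (simp add: harm_Suc angle_def field_simps)
  thus ?case using Suc slope_Suc[OF gap_ge[of m n]] by argo
qed simp

lemma zero_orbit_at_top: "filterlim (zero_orbit m) at_top sequentially"
proof -
  have "filterlim (\<lambda>n. harm n :: real) at_top sequentially" by (rule harm_at_top)
  \<comment> \<open>The slope threshold 32 is the hypothesis of \<open>gap_step\<close> divided by
    the angle.\<close>
  hence "\<forall>\<^sub>F n in sequentially. 16 * (32 - slope m 0) + harm (m + 2) \<le> (harm n :: real)"
    by (simp add: filterlim_at_top)
  then obtain M where M: "\<And>n. n \<ge> M \<Longrightarrow> 16 * (32 - slope m 0) + harm (m + 2) \<le> (harm n :: real)"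
    unfolding eventually_sequentially by blast
  have large: "32 * angle (Suc (m + n)) \<le> gap m n" if "n \<ge> M" for n
  proof -
    have "M \<le> m + n + 2" using that by simp
    have "32 \<le> slope m n"
      using M[OF \<open>M \<le> m + n + 2\<close>] slope_ge_harm[of m n] by argo
    thus ?thesis using angle_pos[of "Suc (m + n)"] by (simp add: slope_def pos_le_divide_eq)
  qed
  have "filterlim (gap m) at_top sequentially"
  proof (rule filterlim_at_top_of_quadratic_growth)
    show "0 < gap m M" using large[of M] angle_pos[of "Suc (m + M)"] by simp
    show "gap m n + 1 / 8 * (gap m n)\<^sup>2 \<le> gap m (Suc n)" if "n \<ge> M" for n
      using gap_step[OF large[OF that]] by (simp add: gap_Suc)
  qed simp
  thus ?thesis
    by (rule filterlim_at_top_mono)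
       (use Re_base_orbit_bounds(1) in \<open>auto simp: gap_def intro!: always_eventually\<close>)
qed

theorem theorem3p6:
  "\<exists>lam :: nat \<Rightarrow> real.
     (\<forall>n\<ge>1. 0 < lam n) \<and> bounded (lam ` {1..}) \<and>
     (\<forall>n1. filterlim (\<lambda>n. comp_from lam n1 n 0) at_infinity sequentially) \<and>
     julia_set lam \<noteq> UNIV"
proof (intro exI[of _ base_param] conjI allI impI)
  have "norm (base_param n) \<le> 2" if "n \<ge> 1" for n
    using base_param_le[of "n - 1"] base_param_pos[of n] that by simp
  thus "bounded (base_param ` {1..})"
    unfolding bounded_iff by auto
  show "filterlim (\<lambda>n. comp_from base_param m n 0) at_infinity sequentially" for m
    unfolding comp_from_zero_eq
    by (rule filterlim_compose[OF filterlim_of_real_at_infinity zero_orbit_at_top])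
  show "julia_set base_param \<noteq> UNIV"
    using base_orbit_in_fatou_set by (auto simp: julia_set_def)
qed (rule base_param_pos)

end
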